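(* The Lüroth map $\mathcal{L}:[0,1]\to[0,1]$ is Li–Yorke chaotic. In fact, there exists a scrambled set $S\subseteq[0,1]$ under $\mathcal{L}$ which is dense in $[0,1]$ and has full Hausdorff dimension, i.e. $\dim_{\mathrm H} S=1$.
   Context: For $x\in(0,1]$, $a_1(x)$ is the unique integer $\ge 2$ with $\frac{1}{a_1(x)}<x\le\frac{1}{a_1(x)-1}$. The Lüroth map $\mathcal{L}:[0,1]\to[0,1]$ is $\mathcal{L}(x)=a_1(x)(a_1(x)-1)x-(a_1(x)-1)$ for $x\in(0,1]$ and $\mathcal{L}(0)=0$; $\mathcal{L}^n$ is its $n$-th iterate. A scrambled set under $\mathcal{L}$ is an uncountable set $S\subseteq[0,1]$ such that all $x,y\in S$ with $x\ne y$ form a Li–Yorke pair, i.e. $\liminf_{n\to\infty}|\mathcal{L}^n(x)-\mathcal{L}^n(y)|=0$ and $\limsup_{n\to\infty}|\mathcal{L}^n(x)-\mathcal{L}^n(y)|>0$. $\mathcal{L}$ is Li–Yorke chaotic if a scrambled set under $\mathcal{L}$ exists. $\dim_{\mathrm H}$ denotes Hausdorff dimension. *)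

theory Defs
  imports "HOL-Analysis.Analysis"
begin

section \<open>The Lueroth map\<close>

definition luroth_digit :: "real \<Rightarrow> int" where
  "luroth_digit x = (THE n. n \<ge> 2 \<and> 1 / of_int n < x \<and> x \<le> 1 / (of_int n - 1))"

lemma luroth_digit_ex1:
  fixes x :: real
  assumes "0 < x" "x \<le> 1"
  shows "\<exists>!n::int. n \<ge> 2 \<and> 1 / of_int n < x \<and> x \<le> 1 / (of_int n - 1)"
proof -
  have *: "(n \<ge> 2 \<and> 1 / of_int n < x \<and> x \<le> 1 / (of_int n - 1)) \<longleftrightarrow> n = \<lfloor>1 / x\<rfloor> + 1" for n :: int
  proof
    assume n: "n \<ge> 2 \<and> 1 / of_int n < x \<and> x \<le> 1 / (of_int n - 1)"
    then have "(1::real) < of_int n" by simp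
    with n assms have "of_int n - 1 \<le> 1 / x" "1 / x < of_int n"
      by (auto simp: field_simps)
    then show "n = \<lfloor>1 / x\<rfloor> + 1" by linarith
  next
    assume n: "n = \<lfloor>1 / x\<rfloor> + 1"
    have "1 \<le> 1 / x" using assms by simp
    then have n2: "n \<ge> 2" using n by linarith
    then have "(1::real) < of_int n" by simp
    moreover have "of_int n - 1 \<le> 1 / x" "1 / x < of_int n" using n by linarith+
    ultimately show "n \<ge> 2 \<and> 1 / of_int n < x \<and> x \<le> 1 / (of_int n - 1)"
      using n2 assms by (auto simp: field_simps)
  qed
  show ?thesis unfolding * by simp
qed

lemma luroth_digit:
  assumes "0 < x" "x \<le> 1"
  shows "luroth_digit x \<ge> 2" "1 / of_int (luroth_digit x) < x"
    "x \<le> 1 / (of_int (luroth_digit x) - 1)"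
  using theI'[OF luroth_digit_ex1[OF assms]] unfolding luroth_digit_def by blast+

text \<open>The value 0 is the prescribed one at 0; outside the unit interval it is a dummy value.\<close>

definition luroth :: "real \<Rightarrow> real" where
  "luroth x = (if 0 < x \<and> x \<le> 1
     then of_int (luroth_digit x) * (of_int (luroth_digit x) - 1) * x - (of_int (luroth_digit x) - 1)
     else 0)"

lemma luroth_in_unit_interval: "luroth x \<in> {0..1}"
proof (cases "0 < x \<and> x \<le> 1")
  case True
  define a where "a = (of_int (luroth_digit x) :: real)"
  have "2 \<le> luroth_digit x" "1 / a < x" "x \<le> 1 / (a - 1)"
    using True luroth_digit[of x] by (auto simp: a_def)
  then have a: "2 \<le> a" "1 < a * x" "(a - 1) * x \<le> 1"
    by (auto simp: a_def field_simps)
  have "(a - 1) * 1 \<le> (a - 1) * (a * x)" "a * ((a - 1) * x) \<le> a * 1"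
    using a by (intro mult_left_mono; simp)+
  then have "0 \<le> a * (a - 1) * x - (a - 1)" "a * (a - 1) * x - (a - 1) \<le> 1"
    by (simp_all add: mult_ac)
  then show ?thesis using True by (simp add: luroth_def a_def)
qed (auto simp: luroth_def)


section \<open>Li--Yorke chaos\<close>

definition li_yorke_pair :: "(real \<Rightarrow> real) \<Rightarrow> real \<Rightarrow> real \<Rightarrow> bool" where
  "li_yorke_pair f x y \<longleftrightarrow>
     liminf (\<lambda>n. ereal \<bar>(f ^^ n) x - (f ^^ n) y\<bar>) = 0 \<and>
     limsup (\<lambda>n. ereal \<bar>(f ^^ n) x - (f ^^ n) y\<bar>) > 0"

definition scrambled_set :: "real set \<Rightarrow> (real \<Rightarrow> real) \<Rightarrow> real set \<Rightarrow> bool" where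
  "scrambled_set X f S \<longleftrightarrow>
     S \<subseteq> X \<and> uncountable S \<and> (\<forall>x\<in>S. \<forall>y\<in>S. x \<noteq> y \<longrightarrow> li_yorke_pair f x y)"

definition li_yorke_chaotic :: "real set \<Rightarrow> (real \<Rightarrow> real) \<Rightarrow> bool" where
  "li_yorke_chaotic X f \<longleftrightarrow> (\<exists>S. scrambled_set X f S)"


section \<open>Hausdorff dimension\<close>

text \<open>
  The convention is that the empty set contributes 0 and that the 0-th power of the diameter
  of a nonempty set is 1, so that the 0-dimensional measure is counting measure; this needs a case
  distinction because \<^term>\<open>0 powr 0 = (0::real)\<close>.
\<close>

definition diameter_pow :: "real \<Rightarrow> 'a::metric_space set \<Rightarrow> ennreal" where
  "diameter_pow s U = (if U = {} then 0 else if s = 0 then 1 else ennreal (diameter U powr s))"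

text \<open>
  Boundedness is required explicitly because \<^const>\<open>diameter\<close> is a real supremum, without meaning
  for unbounded sets. Finite covers are included by padding with empty sets.
\<close>

definition hausdorff_premeasure :: "real \<Rightarrow> real \<Rightarrow> 'a::metric_space set \<Rightarrow> ennreal" where
  "hausdorff_premeasure s \<delta> S =
     (INF U \<in> {U :: nat \<Rightarrow> 'a set. S \<subseteq> (\<Union>i. U i) \<and> (\<forall>i. bounded (U i) \<and> diameter (U i) \<le> \<delta>)}.
        \<Sum>i. diameter_pow s (U i))"

definition hausdorff_measure :: "real \<Rightarrow> 'a::metric_space set \<Rightarrow> ennreal" where
  "hausdorff_measure s S = (SUP \<delta>\<in>{0<..}. hausdorff_premeasure s \<delta> S)"

definition hausdorff_dim :: "'a::metric_space set \<Rightarrow> ennreal" where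
  "hausdorff_dim S = (INF s \<in> {s. 0 \<le> s \<and> hausdorff_measure s S = 0}. ennreal s)"

end

theory Submission
  imports Defs "HOL-Real_Asymp.Real_Asymp"
begin

text \<open>
  Points are built by prescribing their Lueroth digits. Sparse positions \<open>2 ^ j\<close> carry markers that
  make any two distinct points a Li--Yorke pair, finite prefixes make the set dense, and the
  other positions carry an arbitrary \<open>y \<in> (0, 1]\<close> written with digits at most \<open>N\<close>. A cylinder of
  such a \<open>y\<close> is longer than the Lueroth cylinder of the same digits by a factor \<open>N / (N - 1)\<close> per digit,
  and Lueroth cylinders shrink at least like \<open>2 ^ -n\<close>; as the markers cost only a subexponential factor,
  reading off \<open>y\<close> from the point is Hoelder of exponent \<open>s\<close> once \<open>N\<close> is large. Covers of
  the set therefore induce covers of \<open>(0, 1]\<close>, which bounds its \<open>s\<close>-dimensional measure from below for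
  every \<open>s < 1\<close>.
\<close>

section \<open>Lueroth expansions\<close>

lemma luroth_digit_eqI:
  assumes "n \<ge> 2" "1 / of_int n < x" "x \<le> 1 / (of_int n - 1)"
  shows "luroth_digit x = n"
proof -
  have "(2::real) \<le> of_int n" using assms(1) by simp
  then have "0 < 1 / (of_int n :: real)" "1 / (of_int n - 1) \<le> (1::real)" by simp_all
  then have "0 < x" "x \<le> 1" using assms by linarith+
  then show ?thesis
    unfolding luroth_digit_def using assms by (intro the1_equality luroth_digit_ex1) auto
qed

text \<open>The length of the cylinder of digit \<open>a\<close>, and so the reciprocal slope of the
  branch of \<open>luroth\<close> on it.\<close>

definition luroth_weight :: "int \<Rightarrow> real" where
  "luroth_weight a = 1 / (of_int a * (of_int a - 1))"

lemma luroth_weight_pos: "a \<ge> 2 \<Longrightarrow> 0 < luroth_weight a"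
  by (simp add: luroth_weight_def)

lemma luroth_weight_le_half:
  assumes "a \<ge> 2" shows "luroth_weight a \<le> 1 / 2"
proof -
  have "(2::real) \<le> of_int a" using assms by simp
  then have "2 * 1 \<le> of_int a * (of_int a - 1 :: real)" by (intro mult_mono) auto
  then show ?thesis by (simp add: luroth_weight_def divide_simps)
qed

lemma inverse_square_le_luroth_weight:
  assumes "a \<ge> 2" "of_int a \<le> b" shows "1 / b\<^sup>2 \<le> luroth_weight a"
proof -
  have "(2::real) \<le> of_int a" using assms by simp
  then show ?thesis using assms(2)
    unfolding luroth_weight_def power2_eq_square by (intro divide_left_mono mult_mono mult_pos_pos) auto
qed

lemma luroth_weight_telescope: "a \<ge> 2 \<Longrightarrow> 1 / of_int a + luroth_weight a = 1 / (of_int a - 1)"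
  by (simp add: luroth_weight_def divide_simps)

lemma luroth_expand:
  assumes "0 < x" "x \<le> 1"
  shows "x = 1 / of_int (luroth_digit x) + luroth_weight (luroth_digit x) * luroth x"
proof -
  define a where "a = (of_int (luroth_digit x) :: real)"
  have "2 \<le> a" using luroth_digit(1)[OF assms] by (simp add: a_def)
  then show ?thesis
    using assms unfolding luroth_def luroth_weight_def a_def[symmetric]
    by (simp add: divide_simps)
qed

text \<open>Cylinders are open on the left, so orbits in (0, 1] never reach 0 and digits exist at
  every step.\<close>

lemma luroth_bounds:
  assumes "0 < x" "x \<le> 1"
  shows "0 < luroth x" "luroth x \<le> 1"
proof -
  have "0 < luroth_weight (luroth_digit x) * luroth x"
    using luroth_expand[OF assms] luroth_digit(2)[OF assms] by linarith
  then show "0 < luroth x"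
    using luroth_weight_pos[OF luroth_digit(1)[OF assms]] by (simp add: zero_less_mult_iff)
qed (use luroth_in_unit_interval in auto)

lemma luroth_iterate_bounds:
  assumes "0 < x" "x \<le> 1"
  shows "0 < (luroth ^^ n) x \<and> (luroth ^^ n) x \<le> 1"
  by (induction n) (use assms luroth_bounds in auto)

lemma luroth_diff:
  assumes "0 < x" "x \<le> 1" "0 < y" "y \<le> 1" "luroth_digit x = luroth_digit y"
  shows "x - y = luroth_weight (luroth_digit x) * (luroth x - luroth y)"
  using luroth_expand[OF assms(1,2)] luroth_expand[OF assms(3,4)] assms(5)
  by (simp add: right_diff_distrib)

text \<open>Every branch is affine, so the inverse slopes multiply along a common prefix of
  digits.\<close>

lemma luroth_iterate_diff:
  assumes "0 < x" "x \<le> 1" "0 < y" "y \<le> 1"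
    "\<And>m. m < n \<Longrightarrow> luroth_digit ((luroth ^^ m) x) = luroth_digit ((luroth ^^ m) y)"
  shows "x - y = (\<Prod>m<n. luroth_weight (luroth_digit ((luroth ^^ m) x))) *
    ((luroth ^^ n) x - (luroth ^^ n) y)"
  using assms(5)
proof (induction n)
  case (Suc n)
  show ?case
    using Suc.IH Suc.prems luroth_diff[of "(luroth ^^ n) x" "(luroth ^^ n) y"]
      luroth_iterate_bounds[OF assms(1,2), of n] luroth_iterate_bounds[OF assms(3,4), of n]
    by (simp add: mult.assoc)
qed simp

text \<open>Larger digits lie further left: \<open>y\<close> is at most the left endpoint of the
  cylinder of \<open>x\<close>, and \<open>x\<close> exceeds that endpoint by exactly the product on
  the left-hand side.\<close>

lemma luroth_gap:
  assumes "0 < x" "x \<le> 1" "0 < y" "y \<le> 1" "luroth_digit x < luroth_digit y"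
  shows "luroth_weight (luroth_digit x) * luroth x \<le> x - y"
proof -
  have "(2::real) \<le> of_int (luroth_digit x)"
    using luroth_digit(1)[OF assms(1,2)] by simp
  moreover have "of_int (luroth_digit x) \<le> (of_int (luroth_digit y) - 1 :: real)"
    using assms(5) by linarith
  ultimately have "1 / (of_int (luroth_digit y) - 1) \<le> 1 / (of_int (luroth_digit x) :: real)"
    by (intro divide_left_mono) auto
  then show ?thesis
    using luroth_digit(3)[OF assms(3,4)] luroth_expand[OF assms(1,2)] by linarith
qed

section \<open>Lueroth series and points with prescribed digits\<close>

definition luroth_point :: "(nat \<Rightarrow> int) \<Rightarrow> real" where
  "luroth_point u = (\<Sum>n. (\<Prod>m<n. luroth_weight (u m)) / of_int (u n))"

lemma luroth_weight_prod_le: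
  assumes "\<And>n. u n \<ge> 2"
  shows "0 < (\<Prod>m<n. luroth_weight (u m))" "(\<Prod>m<n. luroth_weight (u m)) \<le> (1 / 2) ^ n"
proof -
  show "0 < (\<Prod>m<n. luroth_weight (u m))"
    by (intro prod_pos) (use assms luroth_weight_pos in auto)
  have "(\<Prod>m<n. luroth_weight (u m)) \<le> (\<Prod>m<n. 1 / 2)"
    by (intro prod_mono) (use assms luroth_weight_pos luroth_weight_le_half less_imp_le in blast)
  then show "(\<Prod>m<n. luroth_weight (u m)) \<le> (1 / 2) ^ n" by simp
qed

lemma luroth_point_summable:
  assumes "\<And>n. u n \<ge> 2"
  shows "summable (\<lambda>n. (\<Prod>m<n. luroth_weight (u m)) / of_int (u n))"
proof (rule summable_comparison_test')
  show "summable (\<lambda>n. (1 / 2 :: real) ^ n)" by (rule summable_geometric) simp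
  fix n
  have "(2::real) \<le> of_int (u n)" using assms[of n] by simp
  then have "(\<Prod>m<n. luroth_weight (u m)) / of_int (u n) \<le> (1 / 2) ^ n / 1"
    using luroth_weight_prod_le[of u n, OF assms] by (intro frac_le) auto
  then show "norm ((\<Prod>m<n. luroth_weight (u m)) / of_int (u n)) \<le> (1 / 2) ^ n"
    using luroth_weight_prod_le(1)[of u n, OF assms] \<open>2 \<le> of_int (u n)\<close> by simp
qed

lemma luroth_point_rec:
  assumes "\<And>n. u n \<ge> 2"
  shows "luroth_point u = 1 / of_int (u 0) + luroth_weight (u 0) * luroth_point (\<lambda>n. u (Suc n))"
proof -
  have "luroth_point u =
    1 / of_int (u 0) + (\<Sum>n. (\<Prod>m<Suc n. luroth_weight (u m)) / of_int (u (Suc n)))"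
    using suminf_split_head[OF luroth_point_summable, of u, OF assms]
    by (simp add: luroth_point_def del: prod.lessThan_Suc)
  also have "(\<lambda>n. (\<Prod>m<Suc n. luroth_weight (u m)) / of_int (u (Suc n))) =
      (\<lambda>n. luroth_weight (u 0) * ((\<Prod>m<n. luroth_weight (u (Suc m))) / of_int (u (Suc n))))"
    by (simp add: prod.lessThan_Suc_shift del: prod.lessThan_Suc)
  also have "suminf \<dots> = luroth_weight (u 0) * luroth_point (\<lambda>n. u (Suc n))"
    unfolding luroth_point_def
    by (rule suminf_mult) (rule luroth_point_summable, rule assms)
  finally show ?thesis .
qed

lemma luroth_point_bounds:
  assumes u: "\<And>n. u n \<ge> 2"
  shows "0 < luroth_point u" "luroth_point u \<le> 1"
proof -
  have pos: "0 < (of_int (u n) :: real)" for n using u[of n] by simp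
  show "0 < luroth_point u"
    unfolding luroth_point_def
    by (rule suminf_pos[OF luroth_point_summable]) (use u pos luroth_weight_prod_le(1) in auto)
  \<comment> \<open>The subtracted product is the length left for the tail; the induction uses
    \<open>1 / a + luroth_weight a = 1 / (a - 1)\<close>, which is at most 1.\<close>
  have "(\<Sum>n<N. (\<Prod>m<n. luroth_weight (u m)) / of_int (u n)) \<le> 1 - (\<Prod>m<N. luroth_weight (u m))" for N
  proof (induction N)
    case (Suc N)
    have "2 \<le> (of_int (u N) :: real)" using u[of N] by simp
    then have "1 / (of_int (u N) - 1 :: real) \<le> 1" by simp
    then have "1 / of_int (u N) + luroth_weight (u N) \<le> 1"
      using luroth_weight_telescope[OF u, of N] by simp
    then have "(\<Prod>m<N. luroth_weight (u m)) * (1 / of_int (u N) + luroth_weight (u N)) \<le>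
        (\<Prod>m<N. luroth_weight (u m)) * 1"
      using luroth_weight_prod_le(1)[of u N, OF u] by (intro mult_left_mono) auto
    then show ?case using Suc by (simp add: algebra_simps)
  qed simp
  then have "(\<Sum>n<N. (\<Prod>m<n. luroth_weight (u m)) / of_int (u n)) \<le> 1" for N
    using luroth_weight_prod_le(1)[of u N, OF u] by (meson diff_le_eq le_add_same_cancel1 less_imp_le order_trans)
  then show "luroth_point u \<le> 1"
    unfolding luroth_point_def by (intro suminf_le_const luroth_point_summable u)
qed

text \<open>The tail is a point of (0, 1], so the first term plus the scaled tail lands in the
  half-open cylinder of \<open>u 0\<close>. Hence every sequence of digits at least 2
  occurs.\<close>

lemma luroth_luroth_point:
  assumes u: "\<And>n. u n \<ge> 2"
  shows "luroth_digit (luroth_point u) = u 0"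
    "luroth (luroth_point u) = luroth_point (\<lambda>n. u (Suc n))"
proof -
  have b: "0 < luroth_point (\<lambda>n. u (Suc n))" "luroth_point (\<lambda>n. u (Suc n)) \<le> 1"
    by (rule luroth_point_bounds, rule u)+
  have w: "0 < luroth_weight (u 0)" using luroth_weight_pos u by blast
  have "luroth_weight (u 0) * luroth_point (\<lambda>n. u (Suc n)) \<le> luroth_weight (u 0) * 1"
    using b w by (intro mult_left_mono) auto
  then have "luroth_point u \<le> 1 / (of_int (u 0) - 1)"
    using luroth_point_rec[of u, OF u] luroth_weight_telescope[OF u, of 0] by linarith
  moreover have "1 / of_int (u 0) < luroth_point u"
    using luroth_point_rec[of u, OF u] b w by simp
  ultimately show d: "luroth_digit (luroth_point u) = u 0"
    using u by (intro luroth_digit_eqI) auto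
  show "luroth (luroth_point u) = luroth_point (\<lambda>n. u (Suc n))"
    using luroth_expand[OF luroth_point_bounds, of u] luroth_point_rec[of u, OF u] d u w by simp
qed

lemma luroth_digit_iterate_luroth_point:
  assumes "\<And>n. u n \<ge> 2"
  shows "luroth_digit ((luroth ^^ n) (luroth_point u)) = u n"
proof -
  have "(luroth ^^ n) (luroth_point u) = luroth_point (\<lambda>m. u (n + m))"
  proof (induction n)
    case (Suc n)
    then show ?case using luroth_luroth_point(2)[of "\<lambda>m. u (n + m)"] assms by simp
  qed simp
  then show ?thesis using luroth_luroth_point(1)[of "\<lambda>m. u (n + m)"] assms by simp
qed

section \<open>Hausdorff measure\<close>

lemma diameter_pow_antimono:
  assumes "0 \<le> s" "s \<le> t" "bounded U" "diameter U \<le> 1"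
  shows "diameter_pow t U \<le> diameter_pow s U"
proof -
  \<comment> \<open>The case \<open>s = 0\<close> is separate because the power is then 1 by
    convention, even for diameter 0.\<close>
  have "diameter U powr t \<le> diameter U powr s" if "s > 0"
    using diameter_ge_0[OF assms(3)] assms that by (cases "diameter U = 0") (auto intro: powr_mono')
  moreover have "diameter U powr t \<le> 1"
    using powr_mono2[of t "diameter U" 1] diameter_ge_0[OF assms(3)] assms by simp
  ultimately show ?thesis
    using assms(1,2) unfolding diameter_pow_def by (auto simp: ennreal_leI)
qed

lemma hausdorff_premeasure_antimono_exponent:
  fixes S :: "'a::metric_space set"
  assumes "0 \<le> s" "s \<le> t" "\<delta> \<le> 1"
  shows "hausdorff_premeasure t \<delta> S \<le> hausdorff_premeasure s \<delta> S"
  unfolding hausdorff_premeasure_def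
proof (rule INF_mono)
  fix U :: "nat \<Rightarrow> 'a set"
  assume U: "U \<in> {U. S \<subseteq> (\<Union>i. U i) \<and> (\<forall>i. bounded (U i) \<and> diameter (U i) \<le> \<delta>)}"
  have "diameter_pow t (U i) \<le> diameter_pow s (U i)" for i
    using U assms by (intro diameter_pow_antimono) (auto intro: order_trans[of _ \<delta>])
  then show "\<exists>V\<in>{U. S \<subseteq> (\<Union>i. U i) \<and> (\<forall>i. bounded (U i) \<and> diameter (U i) \<le> \<delta>)}.
      (\<Sum>i. diameter_pow t (V i)) \<le> (\<Sum>i. diameter_pow s (U i))"
    using U by (intro bexI[of _ U] suminf_le) auto
qed

lemma hausdorff_premeasure_mono:
  assumes "S \<subseteq> T" shows "hausdorff_premeasure s \<delta> S \<le> hausdorff_premeasure s \<delta> T"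
  unfolding hausdorff_premeasure_def by (intro INF_superset_mono) (use assms in auto)

lemma hausdorff_measure_mono:
  "S \<subseteq> T \<Longrightarrow> hausdorff_measure s S \<le> hausdorff_measure s T"
  unfolding hausdorff_measure_def by (intro SUP_mono' hausdorff_premeasure_mono)

text \<open>The hypothesis says that the inverse of \<open>f\<close> is Hoelder. The part of
  \<open>E\<close> sent into \<open>U i\<close> thus fits in a ball of radius
  \<open>C * diameter (U i) powr s\<close>, and subadditivity of Lebesgue measure bounds the length
  of \<open>E\<close>, whatever \<open>\<delta>\<close> is.\<close>

lemma hausdorff_premeasure_image_ge:
  fixes f :: "real \<Rightarrow> 'a::metric_space"
  assumes s: "0 < s" and C: "0 < C" and E: "E \<in> sets lborel"
    and holder: "\<And>x y. x \<in> E \<Longrightarrow> y \<in> E \<Longrightarrow> dist x y \<le> C * dist (f x) (f y) powr s"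
  shows "emeasure lborel E / ennreal (2 * C) \<le> hausdorff_premeasure s \<delta> (f ` E)"
proof -
  have "emeasure lborel E \<le> ennreal (2 * C) * (\<Sum>i. diameter_pow s (U i))"
    if U: "f ` E \<subseteq> (\<Union>i. U i)" "\<And>i. bounded (U i)" for U :: "nat \<Rightarrow> 'a set"
  proof -
    have "\<exists>V. V \<in> sets lborel \<and> E \<inter> f -` U i \<subseteq> V \<and>
        emeasure lborel V \<le> ennreal (2 * C) * diameter_pow s (U i)" for i
    proof (cases "E \<inter> f -` U i = {}")
      case False
      then obtain x where x: "x \<in> E" "f x \<in> U i" by auto
      define r where "r = C * diameter (U i) powr s"
      have "0 \<le> r" using C by (simp add: r_def)
      have "y \<in> cball x r" if "y \<in> E" "f y \<in> U i" for y
      proof -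
        have "dist x y \<le> C * dist (f x) (f y) powr s" using holder x that by blast
        also have "\<dots> \<le> r"
          unfolding r_def using C s x that U(2)
          by (intro mult_left_mono powr_mono2 diameter_bounded_bound) auto
        finally show ?thesis by simp
      qed
      moreover have "emeasure lborel (cball x r) = ennreal (2 * C) * diameter_pow s (U i)"
      proof -
        have "emeasure lborel (cball x r) = ennreal (2 * r)"
          using \<open>0 \<le> r\<close> by (simp add: cball_eq_atLeastAtMost)
        then show ?thesis
          using x s C by (auto simp: diameter_pow_def r_def mult.assoc simp flip: ennreal_mult)
      qed
      ultimately show ?thesis by (intro exI[of _ "cball x r"]) auto
    qed (intro exI[of _ "{}"], auto)
    then obtain V where V: "\<And>i. V i \<in> sets lborel" "\<And>i. E \<inter> f -` U i \<subseteq> V i"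
      "\<And>i. emeasure lborel (V i) \<le> ennreal (2 * C) * diameter_pow s (U i)"
      by metis
    have "E \<subseteq> (\<Union>i. V i)"
    proof
      fix x assume "x \<in> E"
      moreover then obtain i where "f x \<in> U i" using U(1) by blast
      ultimately show "x \<in> (\<Union>i. V i)" using V(2)[of i] by blast
    qed
    moreover have "(\<Union>i. V i) \<in> sets lborel"
      by (rule sets.countable_UN) (use V(1) in blast)
    ultimately have "emeasure lborel E \<le> emeasure lborel (\<Union>i. V i)"
      by (rule emeasure_mono)
    also have "\<dots> \<le> (\<Sum>i. emeasure lborel (V i))"
      using V(1) by (intro emeasure_subadditive_countably) auto
    also have "\<dots> \<le> (\<Sum>i. ennreal (2 * C) * diameter_pow s (U i))"
      by (intro suminf_le V(3)) auto
    finally show ?thesis by simp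
  qed
  then show ?thesis
    unfolding hausdorff_premeasure_def using C
    by (intro INF_greatest) (auto intro!: divide_le_posI_ennreal)
qed

section \<open>Dimension of subsets of the unit interval\<close>

lemma hausdorff_measure_unit_interval:
  assumes "1 < s" shows "hausdorff_measure s {0..1::real} = 0"
proof -
  have "hausdorff_premeasure s \<delta> {0..1::real} = 0" if \<delta>: "0 < \<delta>" for \<delta>
  proof -
    \<comment> \<open>Cover by \<open>n\<close> intervals of length \<open>1 / n\<close>; the bound
      tends to 0.\<close>
    have "eventually (\<lambda>n. hausdorff_premeasure s \<delta> {0..1::real} \<le> ennreal (real n powr (1 - s))) sequentially"
      using eventually_gt_at_top[of "nat \<lceil>1 / \<delta>\<rceil>"]
    proof eventually_elim
      case (elim n)
      have "0 < 1 / \<delta>" using \<delta> by simp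
      have "1 / \<delta> < real n" using elim by linarith
      then have "0 < real n" using \<open>0 < 1 / \<delta>\<close> by linarith
      with \<open>1 / \<delta> < real n\<close> have n: "0 < real n" "1 / real n \<le> \<delta>"
        using \<delta> by (simp_all add: field_simps)
      define U where "U i = (if i < n then {real i / real n .. real (Suc i) / real n} else {})" for i
      have "x \<in> (\<Union>i. U i)" if "x \<in> {0..1}" for x
      \<comment> \<open>The floor index of \<open>x = 1\<close> would be \<open>n\<close>, outside
        the cover; this endpoint goes to the last interval.\<close>
      proof (cases "x = 1")
        case True
        then have "x \<in> U (n - 1)" using n by (auto simp: U_def divide_simps)
        then show ?thesis by blast
      next
        case False
        define i where "i = nat \<lfloor>x * real n\<rfloor>"
        have x: "0 \<le> x" "x < 1" using that False by auto
        have "0 \<le> x * real n" "x * real n < 1 * real n"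
          using x n by (simp, intro mult_strict_right_mono) auto
        then have "real i \<le> x * real n" "x * real n \<le> real (Suc i)" "i < n"
          unfolding i_def by linarith+
        then have "x \<in> U i" using n by (simp add: U_def divide_simps)
        then show ?thesis by blast
      qed
      moreover have diam: "diameter (U i) = (if i < n then 1 / real n else 0)" for i
      proof -
        have "real i / real n \<le> real (Suc i) / real n"
          by (intro divide_right_mono) auto
        then show ?thesis
          by (simp add: U_def diff_divide_distrib[symmetric] not_less)
      qed
      moreover have "bounded (U i)" for i by (simp add: U_def)
      ultimately have "hausdorff_premeasure s \<delta> {0..1::real} \<le> (\<Sum>i. diameter_pow s (U i))"
        unfolding hausdorff_premeasure_def using n \<delta> by (intro INF_lower) auto
      also have "\<dots> = (\<Sum>i<n. diameter_pow s (U i))"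
        by (intro suminf_finite) (auto simp: U_def diameter_pow_def)
      also have "\<dots> = (\<Sum>i<n. ennreal ((1 / real n) powr s))"
      proof (intro sum.cong refl)
        fix i assume i: "i \<in> {..<n}"
        then have "real i / real n \<in> U i" using n by (simp add: U_def divide_right_mono)
        then have "U i \<noteq> {}" by blast
        then show "diameter_pow s (U i) = ennreal ((1 / real n) powr s)"
          using i diam[of i] assms by (simp add: diameter_pow_def)
      qed
      also have "\<dots> = ennreal (real n * (1 / real n) powr s)"
        by (simp add: ennreal_mult ennreal_of_nat_eq_real_of_nat)
      also have "real n * (1 / real n) powr s = real n powr (1 - s)"
        using n by (simp add: powr_diff powr_divide)
      finally show ?case .
    qed
    moreover have "(\<lambda>n. ennreal (real n powr (1 - s))) \<longlonglongrightarrow> ennreal 0"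
      by (intro tendsto_ennrealI tendsto_neg_powr filterlim_real_sequentially) (use assms in auto)
    ultimately have "hausdorff_premeasure s \<delta> {0..1::real} \<le> ennreal 0"
      by (intro tendsto_lowerbound[of _ _ sequentially]) auto
    then show ?thesis by simp
  qed
  then show ?thesis unfolding hausdorff_measure_def by (simp add: SUP_eq_iff)
qed

lemma hausdorff_dim_eq_1I:
  assumes "S \<subseteq> {0..1::real}"
    and pos: "\<And>s. 0 < s \<Longrightarrow> s < 1 \<Longrightarrow> hausdorff_premeasure s 1 S \<noteq> 0"
  shows "hausdorff_dim S = 1"
proof (rule antisym)
  have "hausdorff_dim S \<le> 1 + ennreal e" if "0 < e" for e
  proof -
    have "hausdorff_measure (1 + e) S = 0"
      using hausdorff_measure_mono[OF assms(1), of "1 + e"] hausdorff_measure_unit_interval[of "1 + e"] that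
      by simp
    then have "hausdorff_dim S \<le> ennreal (1 + e)"
      unfolding hausdorff_dim_def using that by (intro INF_lower) auto
    then show ?thesis using that ennreal_plus[of 1 e] by simp
  qed
  then show "hausdorff_dim S \<le> 1" by (rule ennreal_le_epsilon)
next
  show "1 \<le> hausdorff_dim S"
    unfolding hausdorff_dim_def
  proof (intro INF_greatest, safe)
    fix s :: real assume s: "0 \<le> s" "hausdorff_measure s S = 0"
    have "1 \<le> s"
    proof (rule ccontr)
      assume "\<not> 1 \<le> s"
      \<comment> \<open>The midpoint of \<open>s\<close> and 1 is strictly between 0 and 1 even for
        \<open>s = 0\<close>, so the hypothesis applies to it.\<close>
      then have "hausdorff_premeasure ((s + 1) / 2) 1 S \<le> hausdorff_premeasure s 1 S"
        using s by (intro hausdorff_premeasure_antimono_exponent) auto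
      also have "\<dots> \<le> hausdorff_measure s S"
        unfolding hausdorff_measure_def by (intro SUP_upper) auto
      finally show False using s pos[of "(s + 1) / 2"] \<open>\<not> 1 \<le> s\<close> by simp
    qed
    then show "1 \<le> ennreal s" using ennreal_leI[of 1 s] by simp
  qed
qed

section \<open>Products with sparse factors\<close>

text \<open>The ratio of the products cannot grow once \<open>f \<le> g\<close>, so its maximum over
  the finitely many earlier lengths serves as \<open>C\<close>.\<close>

lemma prod_le_if_eventually_le:
  fixes f g :: "nat \<Rightarrow> real"
  assumes f: "\<And>n. 0 < f n" and g: "\<And>n. 0 < g n" and le: "eventually (\<lambda>n. f n \<le> g n) sequentially"
  shows "\<exists>C>0. \<forall>n. prod f {..<n} \<le> C * prod g {..<n}"
proof -
  obtain M where M: "\<And>n. n \<ge> M \<Longrightarrow> f n \<le> g n"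
    using le by (auto simp: eventually_sequentially)
  have pos: "0 < prod f {..<n}" "0 < prod g {..<n}" for n
    by (intro prod_pos f g)+
  define C where "C = Max ((\<lambda>n. prod f {..<n} / prod g {..<n}) ` {..M})"
  have small: "prod f {..<n} / prod g {..<n} \<le> C" if "n \<le> M" for n
    unfolding C_def using that by (intro Max_ge) auto
  have "prod f {..<n} \<le> C * prod g {..<n}" for n
  proof (cases "n \<le> M")
    case True
    then show ?thesis using small[of n] pos[of n] by (simp add: divide_le_eq)
  next
    case False
    then have "M \<le> n" by simp
    then show ?thesis
    proof (induction n rule: dec_induct)
      case base
      then show ?case using small[of M] pos[of M] by (simp add: divide_le_eq)
    next
      case (step n)
      then have "prod f {..<n} * f n \<le> C * prod g {..<n} * g n"
        using M[of n] f[of n] pos[of n] by (intro mult_mono) auto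
      then show ?case by (simp add: mult.assoc)
    qed
  qed
  moreover have "0 < C" using small[of 0] by simp
  ultimately show ?thesis by blast
qed

text \<open>A geometric sum is less than twice its largest term, here the largest power below
  \<open>n\<close>.\<close>

lemma sum_powers_of_two_less:
  "(\<Sum>m | m < n \<and> m \<in> range ((^) 2). m) \<le> 2 * (n::nat)"
proof (cases n)
  case (Suc n')
  define J where "J = {j::nat. 2 ^ j < n}"
  have "J \<subseteq> {..<n}" unfolding J_def by (auto intro: less_trans[OF less_exp])
  then have fin: "finite J" using finite_subset by blast
  have ne: "J \<noteq> {}" if "n \<noteq> 1"
  proof -
    have "2 ^ 0 < n" using that Suc by simp
    then show ?thesis unfolding J_def by blast
  qed
  have eq: "{m. m < n \<and> m \<in> range ((^) 2)} = (^) 2 ` J" unfolding J_def by auto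
  have inj: "inj_on ((^) (2::nat)) J" by (rule inj_onI) simp
  show ?thesis
  proof (cases "n = 1")
    case True
    then have "{m. m < n \<and> m \<in> range ((^) (2::nat))} = {}" by auto
    then show ?thesis by (simp only: sum.empty)
  next
    case False
    have "(\<Sum>m | m < n \<and> m \<in> range ((^) 2). m) = (\<Sum>j\<in>J. 2 ^ j)"
      unfolding eq using inj by (simp add: sum.reindex)
    also have "\<dots> \<le> (\<Sum>j<Suc (Max J). 2 ^ j)"
      using fin by (intro sum_mono2) (auto simp: less_Suc_eq_le)
    also have "\<dots> \<le> 2 * 2 ^ Max J"
      by (simp only: lessThan_atLeast0 sum_power2) simp
    also have "\<dots> \<le> 2 * n" using Max_in[OF fin ne] False unfolding J_def by simp
    finally show ?thesis .
  qed
qed simp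

text \<open>Charge each sparse factor with \<open>R\<close> raised to its position: a quadratic
  bound in \<open>j\<close> is eventually below \<open>R ^ (2 ^ j)\<close>, and the sparse positions
  below \<open>n\<close> add up to at most \<open>2 * n\<close>.\<close>

lemma prod_subexponential:
  fixes h :: "nat \<Rightarrow> real"
  assumes h: "\<And>n. 0 < h n" and R: "1 < R"
    and off: "eventually (\<lambda>n. n \<notin> range ((^) 2) \<longrightarrow> h n \<le> 1) sequentially"
    and on: "eventually (\<lambda>j. h (2 ^ j) \<le> K * real (j + 4) ^ 2) sequentially"
  shows "\<exists>C>0. \<forall>n. prod h {..<n} \<le> C * R ^ (2 * n)"
proof -
  define g where "g n = (if n \<in> range ((^) 2) then R ^ n else 1)" for n :: nat
  have "eventually (\<lambda>j. h (2 ^ j) \<le> g (2 ^ j)) sequentially"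
  proof -
    have "((\<lambda>x::real. K * (x + 4) ^ 2 / exp (2 powr x * ln R)) \<longlongrightarrow> 0) at_top"
      using R ln_gt_zero[OF R] by real_asymp
    then have "eventually (\<lambda>x::real. K * (x + 4) ^ 2 / exp (2 powr x * ln R) < 1) at_top"
      by (rule order_tendstoD) simp
    then have "eventually (\<lambda>j::nat. K * (real j + 4) ^ 2 / exp (2 powr real j * ln R) < 1) sequentially"
      by (rule eventually_compose_filterlim[OF _ filterlim_real_sequentially])
    with on show ?thesis
    proof eventually_elim
      case (elim j)
      have "exp (2 powr real j * ln R) = R ^ (2 ^ j)"
        using R exp_of_nat_mult[of "2 ^ j" "ln R"] by (simp add: powr_realpow)
      moreover have "0 < R ^ (2 ^ j)" using R by simp
      ultimately show ?case using elim by (simp add: g_def divide_less_eq add.commute)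
    qed
  qed
  then obtain J where J: "\<And>j. j \<ge> J \<Longrightarrow> h (2 ^ j) \<le> g (2 ^ j)"
    by (auto simp: eventually_sequentially)
  have "eventually (\<lambda>n. h n \<le> g n) sequentially"
    using off eventually_ge_at_top[of "2 ^ J"]
  proof eventually_elim
    case (elim n)
    show ?case
    proof (cases "n \<in> range ((^) 2)")
      case True
      then obtain j where j: "n = 2 ^ j" by blast
      then have "J \<le> j" using elim(2) by simp
      then show ?thesis using J j by simp
    qed (use elim in \<open>simp add: g_def\<close>)
  qed
  moreover have "0 < g n" for n using R by (simp add: g_def)
  ultimately obtain C where C: "C > 0" "\<And>n. prod h {..<n} \<le> C * prod g {..<n}"
    using prod_le_if_eventually_le[of h g] h by blast
  have "prod g {..<n} \<le> R ^ (2 * n)" for n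
  proof -
    have "prod g {..<n} = (\<Prod>m\<in>{m. m < n \<and> m \<in> range ((^) 2)}. R ^ m)"
      unfolding g_def by (simp add: prod.If_cases Int_def lessThan_def)
    also have "\<dots> = R ^ (\<Sum>m | m < n \<and> m \<in> range ((^) 2). m)"
      by (simp add: power_sum)
    also have "\<dots> \<le> R ^ (2 * n)"
      using R sum_powers_of_two_less[of n] by (intro power_increasing) auto
    finally show ?thesis .
  qed
  then have "prod h {..<n} \<le> C * R ^ (2 * n)" for n
    using C(2)[of n] C(1) by (meson less_imp_le mult_left_mono order_trans)
  then show ?thesis using C(1) by blast
qed

section \<open>The coded points\<close>

text \<open>
  The pair \<open>(k, y)\<close> with \<open>y \<in> (0, 1]\<close> is coded by the point \<open>coded_point k y\<close>. Its first
  \<open>prefix_length k\<close> digits are those of \<open>prefix_target k\<close>. After that, the digits at the positions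
  \<open>2 ^ j\<close> are markers, and the remaining (free) positions spell out \<open>y\<close> in the system
  \<open>y \<mapsto> luroth (shrink k y)\<close>, which is the Lueroth system restricted to the digits \<open>2, \<dots>, k + 2\<close>
  and rescaled to \<open>(0, 1]\<close>; its state advances at free positions only.
\<close>

definition prefix_target :: "nat \<Rightarrow> real" where
  "prefix_target k = (let q = real_of_rat (fst (from_nat k :: rat \<times> nat)) in if 0 < q \<and> q \<le> 1 then q else 1)"

definition prefix_length :: "nat \<Rightarrow> nat" where
  "prefix_length k = snd (from_nat k :: rat \<times> nat)"

definition is_free :: "nat \<Rightarrow> nat \<Rightarrow> bool" where
  "is_free k n \<longleftrightarrow> prefix_length k \<le> n \<and> n \<notin> range ((^) 2)"

text \<open>The affine map of (0, 1] onto the union of the cylinders of the digits 2 to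
  \<open>k + 2\<close>.\<close>

definition shrink :: "nat \<Rightarrow> real \<Rightarrow> real" where
  "shrink k y = 1 / real (k + 2) + (1 - 1 / real (k + 2)) * y"

primrec coded_state :: "nat \<Rightarrow> real \<Rightarrow> nat \<Rightarrow> real" where
  "coded_state k y 0 = y"
| "coded_state k y (Suc n) = (if is_free k n then luroth (shrink k (coded_state k y n)) else coded_state k y n)"

text \<open>A Dedekind cut coded by naturals, so that distinct reals differ at some index; the shift
  by \<open>Suc\<close> reserves index 0.\<close>

definition rational_cut :: "real \<Rightarrow> nat set" where
  "rational_cut z = {Suc i | i. real_of_rat (from_nat i) < z}"

text \<open>
  Each index \<open>i\<close> recurs infinitely often among the markers. As \<open>0\<close> belongs to no cut, the markers for
  \<open>i = 0\<close> are common large digits and bring any two orbits close together; an index that separates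
  two cuts yields the digit 2 against a digit at least 4.
\<close>

definition marker :: "nat set \<Rightarrow> nat \<Rightarrow> int" where
  "marker A j = (case prod_decode j of (i, l) \<Rightarrow> if i \<in> A then 2 else int l + 4)"

text \<open>The markers encode \<open>real k + y\<close>: as \<open>y\<close> lies in (0, 1], this
  real determines both \<open>k\<close> and \<open>y\<close>, so points of different families are
  separated too.\<close>

definition coded_digit :: "nat \<Rightarrow> real \<Rightarrow> nat \<Rightarrow> int" where
  "coded_digit k y n =
    (if n < prefix_length k then luroth_digit ((luroth ^^ n) (prefix_target k))
     else if n \<in> range ((^) 2) then marker (rational_cut (real k + y)) (inv ((^) 2) n)
     else luroth_digit (shrink k (coded_state k y n)))"

text \<open>Independent of \<open>y\<close>, which makes the later constants uniform over a family;
  at \<open>2 ^ j\<close> past the prefix it grows only linearly in \<open>j\<close>.\<close>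

definition digit_bound :: "nat \<Rightarrow> nat \<Rightarrow> int" where
  "digit_bound k n =
    (if n < prefix_length k then luroth_digit ((luroth ^^ n) (prefix_target k))
     else if n \<in> range ((^) 2) then int (inv ((^) 2) n) + 4
     else int k + 2)"

definition coded_point :: "nat \<Rightarrow> real \<Rightarrow> real" where
  "coded_point k y = luroth_point (coded_digit k y)"

section \<open>Bounds on states and digits\<close>

lemma inv_power_two [simp]: "inv ((^) (2::nat)) (2 ^ j) = j"
  by (rule inv_f_f) (simp add: inj_def)

lemma prefix_target_bounds: "0 < prefix_target k" "prefix_target k \<le> 1"
  by (simp_all add: prefix_target_def Let_def)

lemma shrink_bounds:
  assumes "0 < y" "y \<le> 1"
  shows "1 / real (k + 2) < shrink k y" "0 < shrink k y" "shrink k y \<le> 1"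
proof -
  define p where "p = 1 / real (k + 2)"
  have p: "0 < p" "p < 1" by (simp_all add: p_def)
  then have "0 < (1 - p) * y" "0 \<le> (1 - p) * (1 - y)"
    using assms by simp_all
  moreover have "shrink k y = p + (1 - p) * y" by (simp add: shrink_def p_def)
  moreover have "1 - (p + (1 - p) * y) = (1 - p) * (1 - y)" by (simp add: algebra_simps)
  ultimately show "1 / real (k + 2) < shrink k y" "0 < shrink k y" "shrink k y \<le> 1"
    unfolding p_def[symmetric] using p by linarith+
qed

lemma luroth_digit_shrink_le:
  assumes "0 < y" "y \<le> 1"
  shows "luroth_digit (shrink k y) \<le> int k + 2"
proof -
  define a where "a = luroth_digit (shrink k y)"
  have "2 \<le> a" "1 / real (k + 2) < 1 / (of_int a - 1)"
    using luroth_digit[OF shrink_bounds(2,3)[OF assms, of k]] shrink_bounds(1)[OF assms, of k]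
    unfolding a_def by linarith+
  moreover then have "(1::real) < of_int a" by simp
  ultimately have "of_int a - 1 < real (k + 2)" by (simp add: field_simps)
  then show ?thesis unfolding a_def by linarith
qed

lemma coded_state_bounds:
  assumes "0 < y" "y \<le> 1"
  shows "0 < coded_state k y n \<and> coded_state k y n \<le> 1"
  by (induction n) (use assms luroth_bounds shrink_bounds in auto)

lemma marker_bounds: "2 \<le> marker A j" "marker A j \<le> int j + 4"
proof -
  obtain i l where il: "prod_decode j = (i, l)" by (cases "prod_decode j")
  then have "j = prod_encode (i, l)" by (metis prod_decode_inverse)
  then have "l \<le> j" using le_prod_encode_2 by simp
  then show "2 \<le> marker A j" "marker A j \<le> int j + 4" by (auto simp: marker_def il)
qed

lemma coded_digit_bounds:
  assumes "0 < y" "y \<le> 1"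
  shows "2 \<le> coded_digit k y n" "coded_digit k y n \<le> digit_bound k n"
proof -
  have "2 \<le> luroth_digit ((luroth ^^ n) (prefix_target k))"
    using luroth_iterate_bounds[OF prefix_target_bounds] by (intro luroth_digit) auto
  moreover have "2 \<le> luroth_digit (shrink k (coded_state k y n))"
    using coded_state_bounds[OF assms, of k n] shrink_bounds by (intro luroth_digit) auto
  moreover have "luroth_digit (shrink k (coded_state k y n)) \<le> int k + 2"
    using coded_state_bounds[OF assms, of k n] by (intro luroth_digit_shrink_le) auto
  ultimately show "2 \<le> coded_digit k y n" "coded_digit k y n \<le> digit_bound k n"
    using marker_bounds by (auto simp: coded_digit_def digit_bound_def)
qed

lemma coded_point_bounds:
  assumes "0 < y" "y \<le> 1"
  shows "0 < coded_point k y" "coded_point k y \<le> 1"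
  unfolding coded_point_def using luroth_point_bounds[of "coded_digit k y"] coded_digit_bounds(1)[OF assms] by auto

lemma luroth_digit_iterate_point:
  assumes "0 < y" "y \<le> 1"
  shows "luroth_digit ((luroth ^^ n) (coded_point k y)) = coded_digit k y n"
  unfolding coded_point_def by (intro luroth_digit_iterate_luroth_point coded_digit_bounds(1)[OF assms])

section \<open>Markers and the Li-Yorke property\<close>

lemma rational_cut_inject:
  assumes "z \<noteq> z'" shows "\<exists>i. i \<in> rational_cut z \<longleftrightarrow> i \<notin> rational_cut z'"
proof -
  have *: "\<exists>i. i \<in> rational_cut z' \<and> i \<notin> rational_cut z" if less: "z < z'" for z z'
  proof -
    obtain q where q: "z < real_of_rat q" "real_of_rat q < z'"
      using of_rat_dense[OF less] by blast
    then have "Suc (to_nat q) \<in> rational_cut z'" "Suc (to_nat q) \<notin> rational_cut z" by (auto simp: rational_cut_def)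
    then show ?thesis by blast
  qed
  from assms show ?thesis using *[of z z'] *[of z' z] by (cases "z < z'") auto
qed

lemma add_index_inject:
  assumes "0 < y" "y \<le> 1" "0 < y'" "y' \<le> 1" "real k + y = real k' + y'"
  shows "k = k'" "y = y'"
proof -
  have "real k < real k' + 1" "real k' < real k + 1" using assms by linarith+
  then show k: "k = k'" by linarith
  show "y = y'" using assms(5) unfolding k by simp
qed

text \<open>Both points carry the marker of a pair \<open>(i, l)\<close> at the same position
  \<open>2 ^ prod_encode (i, l)\<close>, and \<open>l\<close> may be taken as large as
  desired.\<close>

lemma frequently_marker:
  assumes "0 < y" "y \<le> 1" "0 < y'" "y' \<le> 1"
  shows "\<exists>\<^sub>F n in sequentially. \<exists>l\<ge>L.
    coded_digit k y n = (if i \<in> rational_cut (real k + y) then 2 else int l + 4) \<and>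
    coded_digit k' y' n = (if i \<in> rational_cut (real k' + y') then 2 else int l + 4)"
  unfolding frequently_sequentially
proof
  fix M
  \<comment> \<open>As \<open>l \<le> prod_encode (i, l) < n\<close>, this choice puts
    \<open>n\<close> beyond \<open>M\<close> and both prefixes.\<close>
  define l where "l = L + M + prefix_length k + prefix_length k'"
  define n :: nat where "n = 2 ^ prod_encode (i, l)"
  have "l \<le> prod_encode (i, l)" by (rule le_prod_encode_2)
  also have "\<dots> < n" unfolding n_def by (rule less_exp)
  finally have "M \<le> n" "prefix_length k \<le> n" "prefix_length k' \<le> n" "L \<le> l"
    unfolding l_def by linarith+
  moreover have "n \<in> range ((^) 2)" "inv ((^) 2) n = prod_encode (i, l)" by (simp_all add: n_def)
  ultimately show "\<exists>n\<ge>M. \<exists>l\<ge>L.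
    coded_digit k y n = (if i \<in> rational_cut (real k + y) then 2 else int l + 4) \<and>
    coded_digit k' y' n = (if i \<in> rational_cut (real k' + y') then 2 else int l + 4)"
    by (intro exI[of _ n] exI[of _ l] conjI) (auto simp: coded_digit_def marker_def)
qed

lemma coded_point_li_yorke_pair:
  assumes y: "0 < y" "y \<le> 1" and y': "0 < y'" "y' \<le> 1" and ne: "(k, y) \<noteq> (k', y')"
  shows "li_yorke_pair luroth (coded_point k y) (coded_point k' y')"
proof -
  define X where "X n = (luroth ^^ n) (coded_point k y)" for n
  define X' where "X' n = (luroth ^^ n) (coded_point k' y')" for n
  have b: "0 < X n" "X n \<le> 1" "0 < X' n" "X' n \<le> 1" for n
    using luroth_iterate_bounds[OF coded_point_bounds[OF y]] luroth_iterate_bounds[OF coded_point_bounds[OF y']]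
    by (auto simp: X_def X'_def)
  have d: "luroth_digit (X n) = coded_digit k y n" "luroth_digit (X' n) = coded_digit k' y' n" for n
    unfolding X_def X'_def by (rule luroth_digit_iterate_point[OF y] luroth_digit_iterate_point[OF y'])+
  have small: "X n \<le> 1 / (real l + 3)" if "coded_digit k y n = int l + 4" for n l
    using luroth_digit(3)[OF b(1,2), of n] d(1)[of n] that by (simp add: add.commute)
  have small': "X' n \<le> 1 / (real l + 3)" if "coded_digit k' y' n = int l + 4" for n l
    using luroth_digit(3)[OF b(3,4), of n] d(2)[of n] that by (simp add: add.commute)
  have third: "1 / (real l + 3) \<le> 1 / 3" for l by (simp add: divide_simps)
  have "0 \<notin> rational_cut z" for z by (simp add: rational_cut_def)
  \<comment> \<open>Index 0 lies in no cut, so both orbits meet the same digit \<open>l + 4\<close>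
    and are at most \<open>1 / (l + 3)\<close>.\<close>
  then have close: "\<exists>\<^sub>F n in sequentially. \<bar>X n - X' n\<bar> \<le> e" if "0 < e" for e
    using frequently_marker[OF y y', of "nat \<lceil>1 / e\<rceil>" k 0 k']
  proof (elim frequently_elim1)
    fix n assume "\<exists>l\<ge>nat \<lceil>1 / e\<rceil>. 
      coded_digit k y n = (if 0 \<in> rational_cut (real k + y) then 2 else int l + 4) \<and>
      coded_digit k' y' n = (if 0 \<in> rational_cut (real k' + y') then 2 else int l + 4)"
    then obtain l where l: "l \<ge> nat \<lceil>1 / e\<rceil>" "coded_digit k y n = int l + 4" "coded_digit k' y' n = int l + 4"
      using \<open>\<And>z. 0 \<notin> rational_cut z\<close> by auto
    have "1 / e \<le> real l" using l(1) by linarith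
    then have "1 / (real l + 3) \<le> e" using that by (simp add: field_simps)
    then show "\<bar>X n - X' n\<bar> \<le> e" using small[OF l(2)] small'[OF l(3)] b(1)[of n] b(3)[of n] by linarith
  qed
  have "real k + y \<noteq> real k' + y'"
    using add_index_inject[OF y y', of k k'] ne by auto
  then obtain i where i: "i \<in> rational_cut (real k + y) \<longleftrightarrow> i \<notin> rational_cut (real k' + y')"
    using rational_cut_inject by blast
  \<comment> \<open>A separating index gives digit 2 against a digit at least 4: one orbit is above
    1/2, the other at most 1/3, which differ by 1/6.\<close>
  have far: "\<exists>\<^sub>F n in sequentially. 1 / 6 \<le> \<bar>X n - X' n\<bar>"
    using frequently_marker[OF y y', of 0 k i k']
  proof (elim frequently_elim1)
    fix n assume "\<exists>l\<ge>0. 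
      coded_digit k y n = (if i \<in> rational_cut (real k + y) then 2 else int l + 4) \<and>
      coded_digit k' y' n = (if i \<in> rational_cut (real k' + y') then 2 else int l + 4)"
    then obtain l where l: "coded_digit k y n = (if i \<in> rational_cut (real k + y) then 2 else int l + 4)"
      "coded_digit k' y' n = (if i \<in> rational_cut (real k' + y') then 2 else int l + 4)" by blast
    have "1 / 2 < X n \<and> X' n \<le> 1 / 3 \<or> 1 / 2 < X' n \<and> X n \<le> 1 / 3"
    proof (cases "i \<in> rational_cut (real k + y)")
      case True
      then have "coded_digit k y n = 2" "coded_digit k' y' n = int l + 4" using l i by auto
      then have "1 / 2 < X n" "X' n \<le> 1 / 3"
        using luroth_digit(2)[OF b(1,2), of n] d(1)[of n] order_trans[OF small' third] by auto
      then show ?thesis by blast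
    next
      case False
      then have "coded_digit k y n = int l + 4" "coded_digit k' y' n = 2" using l i by auto
      then have "1 / 2 < X' n" "X n \<le> 1 / 3"
        using luroth_digit(2)[OF b(3,4), of n] d(2)[of n] order_trans[OF small third] by auto
      then show ?thesis by blast
    qed
    then show "1 / 6 \<le> \<bar>X n - X' n\<bar>" by linarith
  qed
  have "liminf (\<lambda>n. ereal \<bar>X n - X' n\<bar>) = 0"
  proof (rule antisym)
    show "liminf (\<lambda>n. ereal \<bar>X n - X' n\<bar>) \<le> 0"
    proof (rule ccontr)
      assume "\<not> liminf (\<lambda>n. ereal \<bar>X n - X' n\<bar>) \<le> 0"
      then obtain e where e: "0 < ereal e" "ereal e < liminf (\<lambda>n. ereal \<bar>X n - X' n\<bar>)"
        using ereal_dense2[of 0 "liminf (\<lambda>n. ereal \<bar>X n - X' n\<bar>)"] by (auto simp: not_le)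
      then have "\<forall>\<^sub>F n in sequentially. e < \<bar>X n - X' n\<bar>"
        using less_LiminfD[OF e(2)] by simp
      with close[of e] e(1) show False
        by (auto simp: frequently_def not_le)
    qed
  qed (intro Liminf_bounded, simp)
  moreover have "limsup (\<lambda>n. ereal \<bar>X n - X' n\<bar>) > 0"
  proof (rule ccontr)
    assume "\<not> limsup (\<lambda>n. ereal \<bar>X n - X' n\<bar>) > 0"
    then have "limsup (\<lambda>n. ereal \<bar>X n - X' n\<bar>) < ereal (1 / 6)"
      by (meson ereal_less(2) le_less_trans not_less zero_less_divide_1_iff zero_less_numeral)
    then have "\<forall>\<^sub>F n in sequentially. \<bar>X n - X' n\<bar> < 1 / 6"
      using Limsup_lessD by fastforce
    with far show False by (auto simp: frequently_def not_le)
  qed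
  ultimately show ?thesis by (simp add: li_yorke_pair_def X_def X'_def)
qed

text \<open>A point is no Li-Yorke pair with itself, as the upper limit would be 0.\<close>

lemma coded_point_inject:
  assumes "0 < y" "y \<le> 1" "0 < y'" "y' \<le> 1" "coded_point k y = coded_point k' y'"
  shows "(k, y) = (k', y')"
proof (rule ccontr)
  assume "(k, y) \<noteq> (k', y')"
  then have "li_yorke_pair luroth (coded_point k y) (coded_point k' y')"
    using coded_point_li_yorke_pair assms by blast
  then show False by (simp add: assms(5) li_yorke_pair_def Limsup_const zero_ereal_def[symmetric])
qed

text \<open>Used for density: both points share the prefix digits, hence a cylinder whose length at
  least halves with each digit.\<close>

lemma coded_point_near_target:
  assumes "0 < y" "y \<le> 1"
  shows "\<bar>coded_point k y - prefix_target k\<bar> \<le> (1 / 2) ^ prefix_length k"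
proof -
  define n where "n = prefix_length k"
  define W where "W = (\<Prod>m<n. luroth_weight (coded_digit k y m))"
  have "coded_point k y - prefix_target k = W * ((luroth ^^ n) (coded_point k y) - (luroth ^^ n) (prefix_target k))"
    using luroth_iterate_diff[OF coded_point_bounds[OF assms] prefix_target_bounds, of n k k]
    by (simp add: luroth_digit_iterate_point[OF assms] W_def n_def coded_digit_def)
  moreover have "\<bar>(luroth ^^ n) (coded_point k y) - (luroth ^^ n) (prefix_target k)\<bar> \<le> 1"
    using luroth_iterate_bounds[OF coded_point_bounds[OF assms, of k], of n]
      luroth_iterate_bounds[OF prefix_target_bounds, of n k] by linarith
  moreover have "0 < W" "W \<le> (1 / 2) ^ n"
    using luroth_weight_prod_le[of "coded_digit k y" n, OF coded_digit_bounds(1)[OF assms]] by (simp_all add: W_def)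
  ultimately have "\<bar>coded_point k y - prefix_target k\<bar> \<le> (1 / 2) ^ n * 1"
    by (simp only: abs_mult) (intro mult_mono; simp)
  then show ?thesis by (simp add: n_def)
qed

section \<open>Hoelder continuity of reading off \<open>y\<close>\<close>

lemma coded_state_diff:
  assumes y: "0 < y" "y \<le> 1" and y': "0 < y'" "y' \<le> 1"
    and eq: "\<And>m. m < n \<Longrightarrow> coded_digit k y m = coded_digit k y' m"
  shows "y - y' = (\<Prod>m<n. if is_free k m then real (k + 2) / real (k + 1) * luroth_weight (coded_digit k y m) else 1) *
    (coded_state k y n - coded_state k y' n)"
  using eq
proof (induction n)
  case (Suc n)
  have "coded_state k y n - coded_state k y' n = (real (k + 2) / real (k + 1) * luroth_weight (coded_digit k y n)) *
      (coded_state k y (Suc n) - coded_state k y' (Suc n))" if free: "is_free k n"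
  proof -
    define a where "a = coded_state k y n"
    define a' where "a' = coded_state k y' n"
    have d: "coded_digit k y n = luroth_digit (shrink k a)" "coded_digit k y' n = luroth_digit (shrink k a')"
      using free by (auto simp: coded_digit_def is_free_def a_def a'_def)
    have b: "0 < a" "a \<le> 1" "0 < a'" "a' \<le> 1"
      using coded_state_bounds[OF y, of k n] coded_state_bounds[OF y', of k n] by (auto simp: a_def a'_def)
    have "shrink k a - shrink k a' = luroth_weight (coded_digit k y n) * (luroth (shrink k a) - luroth (shrink k a'))"
      using luroth_diff[OF shrink_bounds(2,3)[OF b(1,2), of k] shrink_bounds(2,3)[OF b(3,4), of k]]
        Suc.prems[of n] d by simp
    \<comment> \<open>The slope of \<open>shrink k\<close>; its inverse is the factor by which a
      free step exceeds the Lueroth weight.\<close>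
    moreover have "shrink k a - shrink k a' = real (k + 1) / real (k + 2) * (a - a')"
      by (simp add: shrink_def divide_simps) (simp add: algebra_simps)
    ultimately have "a - a' = real (k + 2) / real (k + 1) * (luroth_weight (coded_digit k y n) *
        (luroth (shrink k a) - luroth (shrink k a')))"
      by (simp add: field_simps)
    then show ?thesis using free by (simp add: a_def a'_def mult.assoc)
  qed
  then show ?case using Suc by (simp add: mult.assoc)
qed simp

text \<open>Prefix digits agree, free digits are at most \<open>k + 2\<close>, and distinct markers
  at one position are 2 and a digit at least 4. So a large marker never enters the gap estimate as
  the smaller digit.\<close>

lemma smaller_digit_le:
  assumes "0 < y" "y \<le> 1" "coded_digit k y n < coded_digit k y' n"
  shows "coded_digit k y n \<le> int k + 2"
proof (cases "n < prefix_length k \<or> n \<notin> range ((^) 2)")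
  case True
  then show ?thesis
    using assms(3) luroth_digit_shrink_le coded_state_bounds[OF assms(1,2), of k n] by (auto simp: coded_digit_def)
next
  case False
  then show ?thesis
    using assms(3) by (auto simp: coded_digit_def marker_def split: prod.splits if_splits)
qed

text \<open>The smaller digit belongs to the larger point. By \<open>luroth_gap\<close> the iterates
  at time \<open>n\<close> differ by at least a weight, itself at least
  \<open>1 / real (k + 2) ^ 2\<close>, times the next iterate, which exceeds the reciprocal of its
  own digit; hence the digit bound at \<open>Suc n\<close>.\<close>

lemma coded_point_gap:
  assumes y: "0 < y" "y \<le> 1" and y': "0 < y'" "y' \<le> 1"
    and eq: "\<And>m. m < n \<Longrightarrow> coded_digit k y m = coded_digit k y' m"
    and less: "coded_digit k y n < coded_digit k y' n"
  shows "(\<Prod>m<n. luroth_weight (coded_digit k y m)) \<le>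
    \<bar>coded_point k y - coded_point k y'\<bar> * (real (k + 2) ^ 2 * of_int (digit_bound k (Suc n)))"
proof -
  define W where "W = (\<Prod>m<n. luroth_weight (coded_digit k y m))"
  define X where "X n = (luroth ^^ n) (coded_point k y)" for n
  define X' where "X' n = (luroth ^^ n) (coded_point k y')" for n
  define N where "N = real (k + 2)"
  define b where "b = (of_int (digit_bound k (Suc n)) :: real)"
  have bounds: "0 < X n" "X n \<le> 1" "0 < X' n" "X' n \<le> 1" for n
    using luroth_iterate_bounds[OF coded_point_bounds[OF y]] luroth_iterate_bounds[OF coded_point_bounds[OF y']]
    by (auto simp: X_def X'_def)
  have d: "luroth_digit (X n) = coded_digit k y n" "luroth_digit (X' n) = coded_digit k y' n" for n
    unfolding X_def X'_def by (rule luroth_digit_iterate_point[OF y] luroth_digit_iterate_point[OF y'])+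
  have W: "0 < W" unfolding W_def by (intro luroth_weight_prod_le coded_digit_bounds(1)[OF y])
  have N: "0 < N" by (simp add: N_def)
  have "2 \<le> coded_digit k y (Suc n)" "coded_digit k y (Suc n) \<le> digit_bound k (Suc n)"
    by (rule coded_digit_bounds[OF y])+
  then have b: "(2::real) \<le> of_int (coded_digit k y (Suc n))" "of_int (coded_digit k y (Suc n)) \<le> b"
    by (simp_all add: b_def)
  have "1 / b \<le> 1 / of_int (coded_digit k y (Suc n))"
    using b by (intro divide_left_mono) auto
  also have "\<dots> \<le> X (Suc n)"
    using luroth_digit(2)[OF bounds(1,2), of "Suc n"] d(1)[of "Suc n"] by simp
  finally have "1 / b \<le> X (Suc n)" .
  moreover have "1 / N\<^sup>2 \<le> luroth_weight (coded_digit k y n)"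
    using smaller_digit_le[OF y less] coded_digit_bounds(1)[OF y, of k n] unfolding N_def
    by (intro inverse_square_le_luroth_weight) auto
  ultimately have "1 / N\<^sup>2 * (1 / b) \<le> luroth_weight (coded_digit k y n) * X (Suc n)"
    using b bounds luroth_weight_pos[OF coded_digit_bounds(1)[OF y, of k n]] by (intro mult_mono) auto
  also have "\<dots> \<le> X n - X' n"
    using luroth_gap[OF bounds, of n n] less d by (simp add: X_def)
  finally have gap: "1 / (N\<^sup>2 * b) \<le> X n - X' n" by simp
  have "W = W * (1 / (N\<^sup>2 * b)) * (N\<^sup>2 * b)" using N b by simp
  also have "\<dots> \<le> W * (X n - X' n) * (N\<^sup>2 * b)"
    using gap W b by (intro mult_right_mono mult_left_mono) auto
  also have "W * (X n - X' n) = coded_point k y - coded_point k y'"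
    using luroth_iterate_diff[OF coded_point_bounds[OF y] coded_point_bounds[OF y'], of n k k] eq
    by (simp add: luroth_digit_iterate_point[OF y] luroth_digit_iterate_point[OF y'] W_def X_def X'_def)
  also have "\<dots> * (N\<^sup>2 * b) \<le> \<bar>coded_point k y - coded_point k y'\<bar> * (N\<^sup>2 * b)"
    using b by (intro mult_right_mono) auto
  finally show ?thesis by (simp add: W_def N_def b_def)
qed

lemma coded_point_gap_sym:
  assumes y: "0 < y" "y \<le> 1" and y': "0 < y'" "y' \<le> 1"
    and eq: "\<And>m. m < n \<Longrightarrow> coded_digit k y m = coded_digit k y' m"
    and ne: "coded_digit k y n \<noteq> coded_digit k y' n"
  shows "(\<Prod>m<n. luroth_weight (coded_digit k y m)) \<le>
    \<bar>coded_point k y - coded_point k y'\<bar> * (real (k + 2) ^ 2 * of_int (digit_bound k (Suc n)))"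
proof (cases "coded_digit k y n < coded_digit k y' n")
  case True
  then show ?thesis using coded_point_gap[OF y y' eq] by blast
next
  case False
  then show ?thesis
    using coded_point_gap[OF y' y, of n k] eq ne by (simp add: abs_minus_commute)
qed

text \<open>Both distances are compared with the product \<open>W\<close> of the weights before the
  first differing digit: \<open>coded_point_gap_sym\<close> bounds \<open>W\<close> by the distance
  of the coded points, \<open>coded_state_diff\<close> bounds the distance of \<open>y\<close> and
  \<open>y'\<close> by a rescaled product over free positions.\<close>

lemma coded_point_holder:
  assumes s: "0 < s" "s < 1" and k: "real (k + 2) / real (k + 1) \<le> 2 powr ((1 - s) / 2)"
  shows "\<exists>C>0. \<forall>y\<in>{0<..1}. \<forall>y'\<in>{0<..1}.
    dist y y' \<le> C * dist (coded_point k y) (coded_point k y') powr s"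
proof -
  \<comment> \<open>A free digit gains \<open>2 powr (- (1 - s))\<close>; half of the exponent pays
    for \<open>c\<close>, and this is the other half.\<close>
  define \<eta> :: real where "\<eta> = 2 powr (- ((1 - s) / 2))"
  define N where "N = real (k + 2)"
  define c where "c = real (k + 2) / real (k + 1)"
  define b where "b m = (of_int (digit_bound k m) :: real)" for m
  \<comment> \<open>The weight at a non-free position is at least \<open>1 / (b m)\<^sup>2\<close>;
    dividing by \<open>\<eta>\<close> lets the power of \<open>\<eta>\<close> run over all
    positions.\<close>
  define h where "h m = (if is_free k m then 1 else (b m)\<^sup>2 / \<eta>)" for m
  \<comment> \<open>The product of \<open>h\<close> enters squared and costs
    \<open>R ^ (4 * n)\<close>; the 8 makes \<open>R ^ 4\<close> cancel \<open>\<eta>\<close>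
    exactly.\<close>
  define R where "R = 2 powr ((1 - s) / 8)"
  have \<eta>: "0 < \<eta>" "\<eta> < 1" using s by (auto simp: \<eta>_def powr_less_one)
  have R1: "1 < R" using s by (simp add: R_def gr_one_powr)
  have R4: "R ^ 4 * \<eta> = 1" by (simp add: R_def \<eta>_def powr_power flip: powr_add)
  have N: "2 \<le> N" by (simp add: N_def)
  have b2: "2 \<le> b m" for m
    using coded_digit_bounds[of 1 k m] by (simp add: b_def)
  have h_ge: "b m \<le> h m" if "\<not> is_free k m" for m
  proof -
    have "b m * 1 \<le> b m * b m" using b2[of m] by (intro mult_left_mono) auto
    also have "\<dots> \<le> (b m * b m) / \<eta>"
      using \<eta> b2[of m] by (simp add: le_divide_eq mult_left_le)
    finally show ?thesis using that by (simp add: h_def power2_eq_square)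
  qed
  then have h1: "1 \<le> h m" for m using b2[of m] by (cases "is_free k m") (force simp: h_def)+
  then have h0: "0 < h m" for m by (meson less_le_trans zero_less_one)
  have "\<exists>C>0. \<forall>n. prod h {..<n} \<le> C * R ^ (2 * n)"
  proof (rule prod_subexponential[OF h0 R1])
    show "\<forall>\<^sub>F n in sequentially. n \<notin> range ((^) 2) \<longrightarrow> h n \<le> 1"
      using eventually_ge_at_top[of "prefix_length k"] by eventually_elim (simp add: h_def is_free_def)
    show "\<forall>\<^sub>F j in sequentially. h (2 ^ j) \<le> (1 / \<eta>) * real (j + 4) ^ 2"
      using eventually_ge_at_top[of "prefix_length k"]
    proof eventually_elim
      case (elim j)
      then have "prefix_length k \<le> 2 ^ j" using less_exp[of j] by linarith
      then show ?case by (simp add: h_def is_free_def b_def digit_bound_def add.commute)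
    qed
  qed
  then obtain C where C: "0 < C" "\<And>n. prod h {..<n} \<le> C * R ^ (2 * n)" by blast
  have H1: "1 \<le> prod h {..<n}" for n by (intro prod_ge_1 h1)
  have H_mono: "prod h {..<n} \<le> prod h {..<Suc n}" for n
    using mult_left_mono[OF h1[of n], of "prod h {..<n}"] H1[of n] by simp
  \<comment> \<open>At a free position the renormalisation \<open>c\<close> is paid for by \<open>w powr (1 - s)\<close>, as \<open>w \<le> 1 / 2\<close>,
    with a factor \<open>\<eta> < 1\<close> to spare that absorbs the subexponential cost \<open>h\<close> of the other positions.\<close>
  have factor: "(if is_free k m then c * w else 1) \<le> w powr s * (\<eta> * h m)"
    if w: "0 < w" "w \<le> 1 / 2" "\<not> is_free k m \<Longrightarrow> 1 / (b m)\<^sup>2 \<le> w" for w m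
  proof (cases "is_free k m")
    case True
    have "c * w powr (1 - s) \<le> 2 powr ((1 - s) / 2) * (1 / 2) powr (1 - s)"
      using w s k by (intro mult_mono powr_mono2) (auto simp: c_def)
    also have "\<dots> = \<eta>"
      by (simp add: \<eta>_def powr_divide powr_minus_divide flip: powr_diff)
        (simp add: field_simps flip: powr_add)
    finally have "w powr s * (c * w powr (1 - s)) \<le> w powr s * \<eta>"
      by (intro mult_left_mono) auto
    moreover have "w powr s * w powr (1 - s) = w" using w by (simp flip: powr_add)
    ultimately show ?thesis using True by (simp add: h_def mult_ac)
  next
    case False
    have "1 \<le> w * (b m)\<^sup>2" using w(3)[OF False] b2[of m] by (simp add: divide_le_eq)
    also have "w \<le> w powr s" using w s powr_mono'[of s 1 w] by simp
    finally have "1 \<le> w powr s * (b m)\<^sup>2" by (simp add: mult_right_mono)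
    then show ?thesis using False \<eta> by (simp add: h_def)
  qed
  \<comment> \<open>\<open>N ^ 3\<close> collects \<open>N\<^sup>2\<close> from the gap and
    \<open>N\<close> from the next digit bound; \<open>C\<^sup>2 * R ^ 8\<close> is what remains of
    \<open>(C * r)\<^sup>2\<close> after splitting off \<open>R ^ (4 * n)\<close>.\<close>
  define K where "K = N ^ 3 * C\<^sup>2 * R ^ 8"
  have "dist y y' \<le> K * dist (coded_point k y) (coded_point k y') powr s"
    if y: "0 < y" "y \<le> 1" and y': "0 < y'" "y' \<le> 1" for y y'
  proof (cases "y = y'")
    case False
    then have "coded_point k y \<noteq> coded_point k y'" using coded_point_inject[OF y y', of k k] by auto
    then have "coded_digit k y \<noteq> coded_digit k y'" by (auto simp: coded_point_def)
    then have ex: "\<exists>n. coded_digit k y n \<noteq> coded_digit k y' n" by (simp add: fun_eq_iff)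
    define n where "n = (LEAST n. coded_digit k y n \<noteq> coded_digit k y' n)"
    have ne: "coded_digit k y n \<noteq> coded_digit k y' n" unfolding n_def by (rule LeastI_ex[OF ex])
    have eq: "coded_digit k y m = coded_digit k y' m" if "m < n" for m
      using not_less_Least[of m "\<lambda>n. coded_digit k y n \<noteq> coded_digit k y' n"] that by (simp add: n_def)
    define w where "w m = luroth_weight (coded_digit k y m)" for m
    define W where "W = prod w {..<n}"
    define d where "d = dist (coded_point k y) (coded_point k y')"
    define B where "B = N\<^sup>2 * b (Suc n)"
    define r where "r = R ^ (2 * Suc (Suc n))"
    \<comment> \<open>Position \<open>Suc n\<close> is included because the gap estimate involves
      the digit bound there.\<close>
    define P where "P = prod h {..<Suc (Suc n)}"
    have dig: "2 \<le> coded_digit k y m" "of_int (coded_digit k y m) \<le> b m" for m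
      using coded_digit_bounds[OF y, of k m] by (auto simp: b_def)
    have w: "0 < w m" "w m \<le> 1 / 2" "1 / (b m)\<^sup>2 \<le> w m" for m
      unfolding w_def
      by (intro luroth_weight_pos luroth_weight_le_half inverse_square_le_luroth_weight dig)+
    have W: "0 < W" unfolding W_def by (intro prod_pos) (use w in auto)
    have "0 \<le> d" by (simp add: d_def)
    have B1: "1 \<le> B"
    proof -
      have "1 * 1 \<le> N\<^sup>2 * b (Suc n)"
        using N b2[of "Suc n"] by (intro mult_mono) auto
      then show ?thesis by (simp add: B_def)
    qed
    have "W \<le> d * B"
      using coded_point_gap_sym[OF y y' eq ne]
      by (simp add: W_def w_def d_def B_def N_def b_def dist_real_def)
    then have "W powr s \<le> (d * B) powr s" using W s by (intro powr_mono2) auto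
    also have "\<dots> = d powr s * B powr s" using \<open>0 \<le> d\<close> B1 by (simp add: powr_mult)
    also have "\<dots> \<le> d powr s * B"
      using powr_mono[of s 1 B] B1 s by (intro mult_left_mono) auto
    finally have Ws: "W powr s \<le> d powr s * B" .
    have "dist y y' = (\<Prod>m<n. if is_free k m then c * w m else 1) * \<bar>coded_state k y n - coded_state k y' n\<bar>"
    proof -
      have diff: "y - y' = (\<Prod>m<n. if is_free k m then c * w m else 1) * (coded_state k y n - coded_state k y' n)"
        unfolding c_def w_def by (rule coded_state_diff[OF y y' eq])
      have "0 \<le> (\<Prod>m<n. if is_free k m then c * w m else 1)"
        using w(1) by (intro prod_nonneg) (auto simp: c_def less_imp_le)
      then show ?thesis
        using diff by (simp add: dist_real_def abs_mult)
    qed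
    also have "\<dots> \<le> (\<Prod>m<n. w m powr s * (\<eta> * h m)) * 1"
    proof (intro mult_mono prod_mono conjI)
      show "\<bar>coded_state k y n - coded_state k y' n\<bar> \<le> 1"
        using coded_state_bounds[OF y, of k n] coded_state_bounds[OF y', of k n] by linarith
      show "0 \<le> (\<Prod>m<n. w m powr s * (\<eta> * h m))"
        using \<eta> h0 by (intro prod_nonneg) (auto simp: less_imp_le)
    qed (use w factor c_def in \<open>auto simp: less_imp_le\<close>)
    also have "\<dots> = W powr s * \<eta> ^ n * prod h {..<n}"
      using w by (simp add: prod.distrib W_def prod_powr_distrib less_imp_le)
    also have "\<dots> \<le> (d powr s * (N\<^sup>2 * (N * P))) * \<eta> ^ n * P"
    proof (intro mult_mono)
      have "b (Suc n) \<le> N * P"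
      proof (cases "is_free k (Suc n)")
        case True
        then have "b (Suc n) = N" by (simp add: b_def N_def digit_bound_def is_free_def)
        then show ?thesis using H1[of "Suc (Suc n)"] N by (simp add: P_def)
      next
        case False
        have "b (Suc n) \<le> 1 * h (Suc n)" using h_ge[OF False] by simp
        also have "\<dots> \<le> prod h {..<Suc n} * h (Suc n)"
          using H1[of "Suc n"] h0[of "Suc n"] by (intro mult_right_mono) auto
        also have "\<dots> = 1 * P" by (simp add: P_def)
        also have "\<dots> \<le> N * P" using N H1[of "Suc (Suc n)"] unfolding P_def by (intro mult_right_mono) auto
        finally show ?thesis .
      qed
      then have "d powr s * B \<le> d powr s * (N\<^sup>2 * (N * P))"
        unfolding B_def by (intro mult_left_mono) auto
      with Ws show "W powr s \<le> d powr s * (N\<^sup>2 * (N * P))" by linarith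
      show "prod h {..<n} \<le> P" unfolding P_def using H_mono order_trans by blast
    qed (use \<eta> N H1[of n] H1[of "Suc (Suc n)"] in \<open>auto simp: P_def\<close>)
    also have "\<dots> = d powr s * N ^ 3 * \<eta> ^ n * P\<^sup>2"
      by (simp add: power2_eq_square power3_eq_cube mult_ac)
    also have "\<dots> \<le> d powr s * N ^ 3 * \<eta> ^ n * (C * r)\<^sup>2"
      unfolding P_def r_def using C(2)[of "Suc (Suc n)"] H1[of "Suc (Suc n)"] \<eta> N
      by (intro mult_left_mono power_mono) auto
    also have "\<dots> = K * d powr s * (R ^ 4 * \<eta>) ^ n"
    proof -
      have "2 * Suc (Suc n) * 2 = 8 + 4 * n" by simp
      then have "r\<^sup>2 = R ^ 8 * (R ^ 4) ^ n"
        by (simp only: r_def power_mult[symmetric] power_add[symmetric])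
      then show ?thesis by (simp add: K_def power_mult_distrib mult_ac)
    qed
    finally show ?thesis by (simp add: R4 d_def)
  qed simp
  moreover have "0 < K" using N C R1 by (simp add: K_def)
  ultimately show ?thesis by (intro exI[of _ K]) auto
qed

section \<open>The scrambled set\<close>

text \<open>The union over \<open>k\<close> serves twice: varying prefixes give density, and growing
  \<open>k\<close> gives Hoelder exponents close to 1.\<close>

definition chaos_set :: "real set" where
  "chaos_set = (\<Union>k. coded_point k ` {0<..1})"

lemma scrambled_set_chaos_set: "scrambled_set {0..1} luroth chaos_set"
  unfolding scrambled_set_def
proof (intro conjI ballI impI)
  show "chaos_set \<subseteq> {0..1}"
    unfolding chaos_set_def by (auto simp: coded_point_bounds less_imp_le)
  have "inj_on (coded_point 0) {0<..1}"
    using coded_point_inject[of _ _ 0 0] by (intro inj_onI) auto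
  then have "uncountable (coded_point 0 ` {0<..1})"
    using uncountable_half_open_interval_2[of 0 1] by (simp add: countable_image_inj_eq)
  moreover have "coded_point 0 ` {0<..1} \<subseteq> chaos_set" by (auto simp: chaos_set_def)
  ultimately show "uncountable chaos_set" using countable_subset by blast
qed (auto simp: chaos_set_def intro!: coded_point_li_yorke_pair)

lemma closure_chaos_set: "closure chaos_set = {0..1}"
proof
  show "closure chaos_set \<subseteq> {0..1}"
    using scrambled_set_chaos_set by (intro closure_minimal) (auto simp: scrambled_set_def)
  show "{0..1} \<subseteq> closure chaos_set"
  proof
    fix p :: real assume p: "p \<in> {0..1}"
    have "\<exists>x\<in>chaos_set. dist x p < e" if e: "0 < e" for e
    proof -
      define e' where "e' = min e 1"
      have e': "0 < e'" "e' \<le> e" "e' \<le> 1" using e by (auto simp: e'_def)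
      \<comment> \<open>Taking the rational in (0, 1) keeps \<open>prefix_target\<close> from
        falling back to 1.\<close>
      have "max 0 (p - e' / 2) < min 1 (p + e' / 2)" using e' p by auto
      then obtain q where q: "max 0 (p - e' / 2) < real_of_rat q" "real_of_rat q < min 1 (p + e' / 2)"
        using of_rat_dense by blast
      obtain l where l: "(1 / 2 :: real) ^ l < e' / 2"
        using real_arch_pow_inv[of "e' / 2" "1 / 2"] e' by auto
      define k where "k = to_nat (q, l)"
      have "prefix_target k = real_of_rat q" "prefix_length k = l"
        using q by (auto simp: prefix_target_def prefix_length_def k_def Let_def)
      then have "\<bar>coded_point k 1 - real_of_rat q\<bar> < e' / 2"
        using coded_point_near_target[of 1 k] l by simp
      moreover have "\<bar>real_of_rat q - p\<bar> < e' / 2" using q unfolding max_less_iff_conj min_less_iff_conj by linarith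
      ultimately have "dist (coded_point k 1) p < e" using e'(2) unfolding dist_real_def by linarith
      moreover have "coded_point k 1 \<in> chaos_set" unfolding chaos_set_def by (intro UN_I[of k] imageI) auto
      ultimately show ?thesis by blast
    qed
    then show "p \<in> closure chaos_set" by (simp add: closure_approachable)
  qed
qed

text \<open>For each \<open>s < 1\<close> a single family with large \<open>k\<close> suffices: (0,
  1] has length 1, so the premeasure is at least \<open>1 / (2 * C)\<close>.\<close>

lemma hausdorff_dim_chaos_set: "hausdorff_dim chaos_set = 1"
proof (rule hausdorff_dim_eq_1I)
  show "chaos_set \<subseteq> {0..1}" using scrambled_set_chaos_set by (simp add: scrambled_set_def)
  fix s :: real assume s: "0 < s" "s < 1"
  have "(\<lambda>k. real (k + 2) / real (k + 1)) \<longlonglongrightarrow> 1" by real_asymp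
  moreover have "1 < 2 powr ((1 - s) / 2)" using s by (simp add: gr_one_powr)
  ultimately have "\<forall>\<^sub>F k in sequentially. real (k + 2) / real (k + 1) < 2 powr ((1 - s) / 2)"
    by (rule order_tendstoD)
  then obtain k where "real (k + 2) / real (k + 1) < 2 powr ((1 - s) / 2)"
    by (auto simp: eventually_sequentially)
  then obtain C where C: "0 < C"
    "\<forall>y\<in>{0<..1}. \<forall>y'\<in>{0<..1}. dist y y' \<le> C * dist (coded_point k y) (coded_point k y') powr s"
    using coded_point_holder[OF s, of k] by auto
  then have "emeasure lborel {0<..1::real} / ennreal (2 * C) \<le>
      hausdorff_premeasure s 1 (coded_point k ` {0<..1})"
    using s by (intro hausdorff_premeasure_image_ge) auto
  also have "\<dots> \<le> hausdorff_premeasure s 1 chaos_set"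
    by (rule hausdorff_premeasure_mono) (auto simp: chaos_set_def)
  finally show "hausdorff_premeasure s 1 chaos_set \<noteq> 0"
    using C(1) by (auto simp: ennreal_divide_eq_0_iff)
qed

theorem theorem4:
  shows "li_yorke_chaotic {0..1} luroth \<and>
    (\<exists>S. scrambled_set {0..1} luroth S \<and> closure S = {0..1} \<and> hausdorff_dim S = 1)"
  unfolding li_yorke_chaotic_def
  using scrambled_set_chaos_set closure_chaos_set hausdorff_dim_chaos_set by blast

end
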